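(* Let $d\ge 1$ be a fixed integer. For each $N\in\mathbb{N}$ let $\Gamma_N=\{1,\dots,N\}^d$, let $\mathcal{A}_{\Gamma_N}$ be the Dirichlet-truncated adjacency matrix on $\Gamma_N$, let $\{\psi_N^{(j)}\}_{j=1}^{N^d}$ be an orthonormal basis of $\ell^2(\Gamma_N)$ consisting of eigenfunctions of $\mathcal{A}_{\Gamma_N}$, and let $a_N:\Gamma_N\times\Gamma_N\to\mathbb{C}$ be a diagonal observable with $\|a_N\|_\infty:=\sup_{x\in\Gamma_N}|a_N(x,x)|\le 1$. Then $$\lim_{N\to\infty}\frac{1}{N^d}\sum_{j=1}^{N^d}\left|\langle\psi_N^{(j)},a_N\psi_N^{(j)}\rangle-\langle a_N\rangle\right|^2=0,$$ where $\langle\psi_N^{(j)},a_N\psi_N^{(j)}\rangle=\sum_{x\in\Gamma_N}a_N(x,x)|\psi_N^{(j)}(x)|^2$ and $\langle a_N\rangle:=\frac{1}{\#\Gamma_N}\sum_{x\in\Gamma_N}a_N(x,x)$.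
   Context: $\mathbb{N}$ denotes the positive integers. $\ell^2(\Gamma_N)$ is the space of functions $\Gamma_N\to\mathbb{C}$ with inner product $\langle\varphi,\psi\rangle=\sum_{x\in\Gamma_N}\overline{\varphi(x)}\psi(x)$. The Dirichlet-truncated adjacency matrix $\mathcal{A}_{\Gamma_N}:\ell^2(\Gamma_N)\to\ell^2(\Gamma_N)$ is $$(\mathcal{A}_{\Gamma_N}\psi)(x)=\sum_{y\in\Gamma_N,\ \|y-x\|_1=1}\psi(y),\qquad x\in\Gamma_N,$$ where $\|\cdot\|_1$ is the $\ell^1$-norm on $\mathbb{Z}^d$. An observable is a matrix $T:\Gamma_N\times\Gamma_N\to\mathbb{C}$, acting by $(T\psi)(x)=\sum_{y}T(x,y)\psi(y)$; it is diagonal if $T(x,y)=0$ for $x\ne y$. *)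

theory Defs
  imports "HOL-Analysis.Analysis"
begin

text \<open>
  Points of the \<open>d\<close>-dimensional integer lattice are vectors of type \<open>int ^ 'd\<close>, with
  \<open>d = CARD('d) \<ge> 1\<close>.  An element of \<open>l\<^sup>2(\<Gamma>)\<close>, \<open>\<Gamma>\<close> a finite set of lattice points, is a
  function on the whole lattice of which only the values on \<open>\<Gamma>\<close> matter; likewise for
  observables \<open>\<Gamma> \<times> \<Gamma> \<rightarrow> \<complex>\<close>.  All notions below read values on \<open>\<Gamma>\<close> only.
\<close>

type_synonym 'd wavefun = "int ^ 'd \<Rightarrow> complex"

type_synonym 'd observable = "int ^ 'd \<Rightarrow> int ^ 'd \<Rightarrow> complex"

definition lattice_box :: "nat \<Rightarrow> (int ^ 'd) set" where
  "lattice_box N = {x. \<forall>i. 1 \<le> x $ i \<and> x $ i \<le> int N}"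

definition l1_norm :: "int ^ 'd \<Rightarrow> int" where
  "l1_norm x = (\<Sum>i\<in>UNIV. \<bar>x $ i\<bar>)"

definition l2_inner :: "(int ^ 'd) set \<Rightarrow> 'd wavefun \<Rightarrow> 'd wavefun \<Rightarrow> complex" where
  "l2_inner \<Gamma> \<phi> \<psi> = (\<Sum>x\<in>\<Gamma>. cnj (\<phi> x) * \<psi> x)"

definition dirichlet_adj :: "(int ^ 'd) set \<Rightarrow> 'd wavefun \<Rightarrow> 'd wavefun" where
  "dirichlet_adj \<Gamma> \<psi> x = (\<Sum>y\<in>{y\<in>\<Gamma>. l1_norm (y - x) = 1}. \<psi> y)"

definition eigenfunction_on ::
    "(int ^ 'd) set \<Rightarrow> ('d wavefun \<Rightarrow> 'd wavefun) \<Rightarrow> 'd wavefun \<Rightarrow> bool" where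
  "eigenfunction_on \<Gamma> A \<psi> \<longleftrightarrow>
     (\<exists>x\<in>\<Gamma>. \<psi> x \<noteq> 0) \<and> (\<exists>\<mu>::complex. \<forall>x\<in>\<Gamma>. A \<psi> x = \<mu> * \<psi> x)"

definition orthonormal_basis_on ::
    "(int ^ 'd) set \<Rightarrow> 'j set \<Rightarrow> ('j \<Rightarrow> 'd wavefun) \<Rightarrow> bool" where
  "orthonormal_basis_on \<Gamma> J \<psi> \<longleftrightarrow>
     (\<forall>j\<in>J. \<forall>k\<in>J. l2_inner \<Gamma> (\<psi> j) (\<psi> k) = (if j = k then 1 else 0)) \<and>
     (\<forall>\<phi> :: 'd wavefun. \<exists>c. \<forall>x\<in>\<Gamma>. \<phi> x = (\<Sum>j\<in>J. c j * \<psi> j x))"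

definition obs_apply :: "(int ^ 'd) set \<Rightarrow> 'd observable \<Rightarrow> 'd wavefun \<Rightarrow> 'd wavefun" where
  "obs_apply \<Gamma> T \<psi> x = (\<Sum>y\<in>\<Gamma>. T x y * \<psi> y)"

definition diagonal_obs :: "(int ^ 'd) set \<Rightarrow> 'd observable \<Rightarrow> bool" where
  "diagonal_obs \<Gamma> T \<longleftrightarrow> (\<forall>x\<in>\<Gamma>. \<forall>y\<in>\<Gamma>. x \<noteq> y \<longrightarrow> T x y = 0)"

definition diag_sup_norm :: "(int ^ 'd) set \<Rightarrow> 'd observable \<Rightarrow> real" where
  "diag_sup_norm \<Gamma> T = (SUP x\<in>\<Gamma>. cmod (T x x))"

definition obs_average :: "(int ^ 'd) set \<Rightarrow> 'd observable \<Rightarrow> complex" where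
  "obs_average \<Gamma> T = (1 / of_nat (card \<Gamma>)) * (\<Sum>x\<in>\<Gamma>. T x x)"

lemma l2_inner_diagonal_obs:
  assumes "finite \<Gamma>" and "diagonal_obs \<Gamma> T"
  shows "l2_inner \<Gamma> \<psi> (obs_apply \<Gamma> T \<psi>) = (\<Sum>x\<in>\<Gamma>. T x x * of_real ((cmod (\<psi> x))\<^sup>2))"
  unfolding l2_inner_def
proof (rule sum.cong[OF refl])
  fix x assume x: "x \<in> \<Gamma>"
  have "obs_apply \<Gamma> T \<psi> x = (\<Sum>y\<in>\<Gamma>. if y = x then T x x * \<psi> x else 0)"
    unfolding obs_apply_def using assms(2) x
    by (intro sum.cong) (auto simp: diagonal_obs_def)
  also have "\<dots> = T x x * \<psi> x"
    using assms(1) x by simp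
  finally show "cnj (\<psi> x) * obs_apply \<Gamma> T \<psi> x = T x x * of_real ((cmod (\<psi> x))\<^sup>2)"
    by (simp only: complex_norm_square mult_ac)
qed

lemma lattice_box_eq_image: "lattice_box N = vec_lambda ` (UNIV \<rightarrow>\<^sub>E {1..int N})"
proof (intro equalityI subsetI)
  fix x :: "int ^ 'd"
  assume "x \<in> lattice_box N"
  then have "vec_nth x \<in> UNIV \<rightarrow>\<^sub>E {1..int N}"
    by (auto simp: lattice_box_def)
  then show "x \<in> vec_lambda ` (UNIV \<rightarrow>\<^sub>E {1..int N})"
    by (rule rev_image_eqI) simp
qed (auto simp: lattice_box_def)

lemma finite_lattice_box: "finite (lattice_box N :: (int ^ 'd) set)"
  unfolding lattice_box_eq_image by (intro finite_imageI finite_PiE) auto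

lemma card_lattice_box: "card (lattice_box N :: (int ^ 'd) set) = N ^ CARD('d)"
proof -
  have "inj_on (vec_lambda :: ('d \<Rightarrow> int) \<Rightarrow> _) A" for A
    by (auto simp: inj_on_def vec_lambda_inject)
  then show ?thesis
    unfolding lattice_box_eq_image by (subst card_image) (auto simp: card_PiE)
qed

end

theory Submission
  imports Defs
begin

text \<open>
  Let \<open>b = a - \<langle>a\<rangle>\<close> and \<open>n = N + 1\<close>.  In the coefficients of an eigenfunction with respect to sine
  waves, \<open>\<langle>\<psi>, b \<psi>\<rangle>\<close> is a quadratic form whose matrix at \<open>(k, l)\<close> is the Fourier transform of \<open>b\<close> at \<open>k - l\<close>,
  and only pairs of equal energy \<open>E(k) = E(l)\<close> contribute.  Bessel's inequality for the rank-one
  projections onto the \<open>\<psi>\<^sub>j\<close> bounds the sum of the \<open>|\<langle>\<psi>\<^sub>j, b \<psi>\<^sub>j\<rangle>|\<^sup>2\<close> by the Hilbert-Schmidt norm of the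
  restricted matrix.  Grouping by \<open>m = k - l\<close>, the term \<open>m = 0\<close> vanishes since \<open>b\<close> has mean zero, while
  for \<open>m \<noteq> 0\<close> the equation \<open>E(k - m) = E(k)\<close> fixes one coordinate of \<open>k\<close> up to two choices, so it has
  \<open>O(n\<^bsup>d-1\<^esup>)\<close> solutions.  With Parseval for \<open>b\<close> the normalised variance is \<open>O(1/N)\<close>.
\<close>

section \<open>Bessel and Parseval for finite families\<close>

text \<open>Expand the nonnegative squared norm of \<open>D * u - p\<close>, where \<open>p\<close>
  is the unnormalised projection of \<open>u\<close> onto the span of the \<open>v j\<close>. The
  common squared norm \<open>D\<close> is kept general so that the rank-one matrices built later can
  be used without rescaling.\<close>

lemma bessel_inequality:
  fixes v :: "'j \<Rightarrow> 'x \<Rightarrow> complex" and u :: "'x \<Rightarrow> complex" and D :: real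
  assumes "finite J" and "D > 0"
    and orth: "\<And>i j. i \<in> J \<Longrightarrow> j \<in> J \<Longrightarrow>
      (\<Sum>x\<in>X. cnj (v i x) * v j x) = (if i = j then of_real D else 0)"
  shows "(\<Sum>j\<in>J. (cmod (\<Sum>x\<in>X. cnj (v j x) * u x))\<^sup>2) \<le> D * (\<Sum>x\<in>X. (cmod (u x))\<^sup>2)"
proof -
  define a where "a j = (\<Sum>x\<in>X. cnj (v j x) * u x)" for j
  define p where "p x = (\<Sum>j\<in>J. a j * v j x)" for x
  define A where "A = (\<Sum>j\<in>J. (cmod (a j))\<^sup>2)"
  have pu: "(\<Sum>x\<in>X. cnj (p x) * u x) = of_real A"
  proof -
    have "(\<Sum>x\<in>X. cnj (p x) * u x) = (\<Sum>x\<in>X. \<Sum>j\<in>J. cnj (a j) * (cnj (v j x) * u x))"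
      by (simp add: p_def sum_distrib_right mult.assoc)
    also have "\<dots> = (\<Sum>j\<in>J. cnj (a j) * a j)"
      by (subst sum.swap) (simp add: a_def sum_distrib_left)
    finally show ?thesis
      unfolding A_def of_real_sum complex_norm_square by (simp add: mult.commute)
  qed
  have pp: "(\<Sum>x\<in>X. cnj (p x) * p x) = of_real (D * A)"
  proof -
    have "(\<Sum>x\<in>X. cnj (p x) * p x)
        = (\<Sum>x\<in>X. \<Sum>i\<in>J. \<Sum>j\<in>J. cnj (a i) * a j * (cnj (v i x) * v j x))"
      unfolding p_def cnj_sum sum_product by (simp add: mult_ac)
    also have "\<dots> = (\<Sum>i\<in>J. \<Sum>j\<in>J. \<Sum>x\<in>X. cnj (a i) * a j * (cnj (v i x) * v j x))"
      by (subst sum.swap, intro sum.cong refl, rule sum.swap)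
    also have "\<dots> = (\<Sum>i\<in>J. \<Sum>j\<in>J. if i = j then cnj (a i) * a j * of_real D else 0)"
      by (intro sum.cong refl) (simp add: sum_distrib_left [symmetric] orth)
    also have "\<dots> = of_real (D * A)"
      unfolding A_def of_real_mult of_real_sum complex_norm_square
      using \<open>finite J\<close> by (simp add: sum_distrib_left mult_ac)
    finally show ?thesis .
  qed
  have up: "(\<Sum>x\<in>X. cnj (u x) * p x) = of_real A"
    using arg_cong [OF pu, of cnj] by (simp add: mult.commute)
  have "complex_of_real (\<Sum>x\<in>X. (cmod (of_real D * u x - p x))\<^sup>2)
      = (\<Sum>x\<in>X. of_real (D\<^sup>2) * (cnj (u x) * u x) - of_real D * (cnj (u x) * p x)
          - of_real D * (cnj (p x) * u x) + cnj (p x) * p x)"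
    unfolding of_real_sum complex_norm_square
    by (intro sum.cong refl) (simp add: algebra_simps power2_eq_square)
  also have "\<dots> = of_real (D\<^sup>2) * (\<Sum>x\<in>X. cnj (u x) * u x) - of_real (D * A)"
    by (simp only: sum.distrib sum_subtractf sum_distrib_left [symmetric] pp up pu) simp
  also have "\<dots> = of_real (D\<^sup>2 * (\<Sum>x\<in>X. (cmod (u x))\<^sup>2) - D * A)"
    unfolding of_real_diff of_real_mult [of "D\<^sup>2"] of_real_sum complex_norm_square
    by (simp add: mult.commute)
  finally have "(\<Sum>x\<in>X. (cmod (of_real D * u x - p x))\<^sup>2) = D\<^sup>2 * (\<Sum>x\<in>X. (cmod (u x))\<^sup>2) - D * A"
    using of_real_eq_iff by blast
  then have "0 \<le> D * (D * (\<Sum>x\<in>X. (cmod (u x))\<^sup>2) - A)"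
    using sum_nonneg [of X "\<lambda>x. (cmod (of_real D * u x - p x))\<^sup>2"]
    by (simp add: power2_eq_square algebra_simps)
  then show ?thesis
    using \<open>D > 0\<close> by (simp add: A_def a_def zero_le_mult_iff)
qed

text \<open>The hypothesis is the tight-frame relation with constant \<open>D\<close>. It allows
  \<open>K\<close> to be larger than \<open>X\<close>, as happens for the redundantly indexed waves
  below.\<close>

lemma parseval:
  fixes e :: "'k \<Rightarrow> 'x \<Rightarrow> complex"
  assumes "finite X"
    and frame: "\<And>x y. x \<in> X \<Longrightarrow> y \<in> X \<Longrightarrow>
      (\<Sum>k\<in>K. cnj (e k x) * e k y) = (if x = y then D else 0)"
  shows "(\<Sum>k\<in>K. cnj (\<Sum>x\<in>X. e k x * f x) * (\<Sum>x\<in>X. e k x * g x)) = D * (\<Sum>x\<in>X. cnj (f x) * g x)"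
proof -
  have "(\<Sum>k\<in>K. cnj (\<Sum>x\<in>X. e k x * f x) * (\<Sum>x\<in>X. e k x * g x))
      = (\<Sum>k\<in>K. \<Sum>x\<in>X. \<Sum>y\<in>X. cnj (f x) * g y * (cnj (e k x) * e k y))"
    unfolding cnj_sum sum_product by (simp add: mult_ac)
  also have "\<dots> = (\<Sum>x\<in>X. \<Sum>y\<in>X. \<Sum>k\<in>K. cnj (f x) * g y * (cnj (e k x) * e k y))"
    by (subst sum.swap, intro sum.cong refl, rule sum.swap)
  also have "\<dots> = (\<Sum>x\<in>X. \<Sum>y\<in>X. if x = y then cnj (f x) * g y * D else 0)"
    by (intro sum.cong refl) (simp add: sum_distrib_left [symmetric] frame)
  also have "\<dots> = D * (\<Sum>x\<in>X. cnj (f x) * g x)"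
    using \<open>finite X\<close> by (simp add: sum_distrib_left mult_ac)
  finally show ?thesis .
qed

section \<open>Trigonometric sums over full periods\<close>

lemma dvd_diff_iff_eq:
  fixes q x y :: int
  assumes "\<bar>x - y\<bar> < q"
  shows "q dvd x - y \<longleftrightarrow> x = y"
  using assms dvd_imp_le_int [of "x - y" q] by (cases "x = y") auto

lemma cis_eq_1_iff_dvd:
  fixes n :: nat and t :: int
  assumes "n > 0"
  shows "cis (pi / n * t) = 1 \<longleftrightarrow> 2 * int n dvd t"
proof -
  have "cis (pi / n * t) = 1 \<longleftrightarrow> cos (pi / n * t) = 1"
    by (auto simp: complex_eq_iff intro: cos_one_sin_zero)
  also have "\<dots> \<longleftrightarrow> (\<exists>q::int. pi / n * t = q * 2 * pi)"
    by (simp add: cos_one_2pi_int)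
  also have "\<dots> \<longleftrightarrow> (\<exists>q::int. real_of_int t = real_of_int (2 * int n * q))"
    using assms by (simp add: field_simps)
  also have "\<dots> \<longleftrightarrow> 2 * int n dvd t"
    by (auto simp only: of_int_eq_iff dvd_def)
  finally show ?thesis .
qed

text \<open>A geometric sum whose ratio is a \<open>2 * n\<close>-th root of unity. Here
  \<open>m\<close> counts periods and \<open>r\<close> is the starting point: one period from 0
  serves the wave indices, two periods from \<open>- 2 * n\<close> serve their differences.\<close>

lemma sum_cis_periods:
  fixes n m :: nat and t r :: int
  assumes "n > 0"
  shows "(\<Sum>\<kappa>\<in>{r..<r + 2 * int n * int m}. cis (pi / n * (\<kappa> * t)))
    = (if 2 * int n dvd t then 2 * of_nat n * of_nat m else 0)"
proof -
  define w where "w = cis (pi / n * t)"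
  have "(\<Sum>\<kappa>\<in>{r..<r + 2 * int n * int m}. cis (pi / n * (\<kappa> * t)))
      = (\<Sum>j<2 * n * m. cis (pi / n * (real_of_int (r + int j) * t)))"
    by (rule sum.reindex_bij_witness [of _ "\<lambda>j. r + int j" "\<lambda>\<kappa>. nat (\<kappa> - r)"])
       (auto simp: nat_less_iff simp flip: of_nat_less_iff [where 'a = int])
  also have "\<dots> = cis (pi / n * (r * t)) * (\<Sum>j<2 * n * m. w ^ j)"
    unfolding sum_distrib_left w_def
    by (intro sum.cong refl) (simp add: Complex.DeMoivre cis_mult algebra_simps)
  also have "\<dots> = (if 2 * int n dvd t then 2 * of_nat n * of_nat m else 0)"
  proof (cases "2 * int n dvd t")
    case True
    then have "w = 1" "cis (pi / n * (r * t)) = 1"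
      using cis_eq_1_iff_dvd [OF assms, of t] cis_eq_1_iff_dvd [OF assms, of "r * t"]
      by (auto simp: w_def)
    with True show ?thesis by simp
  next
    case False
    have "w ^ (2 * n) = 1"
      using assms cis_eq_1_iff_dvd [OF assms, of "2 * int n * t"]
      by (simp add: w_def Complex.DeMoivre mult_ac)
    then have "w ^ (2 * n * m) = 1"
      by (simp add: power_mult)
    moreover have "w \<noteq> 1"
      using False cis_eq_1_iff_dvd [OF assms] by (simp add: w_def)
    ultimately show ?thesis
      using False by (simp add: geometric_sum)
  qed
  finally show ?thesis .
qed

text \<open>The product splits into exponentials at \<open>y + x\<close> and \<open>y - x\<close>.
  Since \<open>y + x\<close> lies strictly between 0 and \<open>2 * n\<close>, only the second can
  resonate, and only for \<open>x = y\<close>.\<close>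

lemma sum_sin_cis:
  fixes n :: nat and x y :: int
  assumes "0 < x" "x < int n" "0 < y" "y < int n"
  shows "(\<Sum>\<kappa>\<in>{0..<2 * int n}. of_real (sin (pi / n * (\<kappa> * x))) * cis (pi / n * (\<kappa> * y)))
    = (if x = y then \<i> * of_nat n else 0)"
proof -
  have n: "n > 0" using assms by simp
  have ndvd: "\<not> 2 * int n dvd (y + x)" and dvd: "2 * int n dvd (y - x) \<longleftrightarrow> x = y"
    using assms zdvd_imp_le [of "2 * int n" "y + x"] dvd_diff_iff_eq [of y x "2 * int n"]
    by auto
  have *: "of_real (sin u) * cis v = (cis (v + u) - cis (v - u)) / (2 * \<i>)" for u v
    by (auto simp: complex_eq_iff Re_divide Im_divide cos_add cos_diff sin_add sin_diff
        power2_eq_square)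
  have "(\<Sum>\<kappa>\<in>{0..<2 * int n}. of_real (sin (pi / n * (\<kappa> * x))) * cis (pi / n * (\<kappa> * y)))
     = (\<Sum>\<kappa>\<in>{0..<2 * int n}. cis (pi / n * (\<kappa> * (y + x)))
         - cis (pi / n * (\<kappa> * (y - x)))) / (2 * \<i>)"
    unfolding * sum_divide_distrib by (simp add: algebra_simps)
  also have "\<dots> = ((if 2 * int n dvd (y + x) then 2 * of_nat n else 0)
      - (if 2 * int n dvd (y - x) then 2 * of_nat n else 0)) / (2 * \<i>)"
    using sum_cis_periods [OF n, of "y + x" 0 1] sum_cis_periods [OF n, of "y - x" 0 1]
    by (simp add: sum_subtractf)
  also have "\<dots> = (if x = y then \<i> * of_nat n else 0)"
    using ndvd dvd by (auto simp: divide_simps)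
  finally show ?thesis .
qed

lemma sum_sin_sin:
  fixes n :: nat and x y :: int
  assumes "0 < x" "x < int n" "0 < y" "y < int n"
  shows "(\<Sum>\<kappa>\<in>{0..<2 * int n}. sin (pi / n * (\<kappa> * x)) * sin (pi / n * (\<kappa> * y)))
    = (if x = y then n else 0)"
  using arg_cong [OF sum_sin_cis [OF assms], of Im] by (auto simp: Im_sum)

section \<open>Resonances in one coordinate\<close>

lemma card_cos_diff_le:
  fixes n :: nat and m :: int and c :: real
  assumes "n > 0" "\<not> 2 * int n dvd m"
  shows "card {\<kappa> \<in> {0..<2 * int n}. cos (pi / n * (\<kappa> - m)) - cos (pi / n * \<kappa>) = c} \<le> 2"
proof -
  \<comment> \<open>The condition on \<open>\<kappa>\<close> says \<open>Re (\<alpha> z) = c\<close> for \<open>z\<close> on the unit circle, a quadratic equation for \<open>z\<close>.\<close>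
  define \<alpha> where "\<alpha> = cis (- (pi / n * m)) - 1"
  define z where "z \<kappa> = cis (pi / n * real_of_int \<kappa>)" for \<kappa> :: int
  define p where "p = [: cnj \<alpha>, - 2 * of_real c, \<alpha> :]"
  let ?S = "{\<kappa> \<in> {0..<2 * int n}. cos (pi / n * (\<kappa> - m)) - cos (pi / n * \<kappa>) = c}"
  \<comment> \<open>The divisibility hypothesis keeps the leading coefficient from vanishing, so
    \<open>p\<close> is a genuine quadratic.\<close>
  have "\<alpha> \<noteq> 0"
    using cis_eq_1_iff_dvd [OF assms(1), of "- m"] assms(2) by (simp add: \<alpha>_def)
  then have p: "p \<noteq> 0" "degree p = 2"
    by (simp_all add: p_def)
  have "inj_on z {0..<2 * int n}"
  proof (rule inj_onI)
    fix k l assume kl: "k \<in> {0..<2 * int n}" "l \<in> {0..<2 * int n}" and "z k = z l"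
    then have "cis (pi / n * real_of_int (k - l)) = 1"
      by (simp add: z_def right_diff_distrib flip: cis_divide)
    then have "2 * int n dvd (k - l)"
      by (simp only: cis_eq_1_iff_dvd [OF assms(1)])
    with kl show "k = l"
      using dvd_diff_iff_eq [of k l "2 * int n"] by auto
  qed
  then have "card ?S = card (z ` ?S)"
    by (intro card_image [symmetric]) (auto elim: inj_on_subset)
  also have "\<dots> \<le> card {x. poly p x = 0}"
  proof (intro card_mono poly_roots_finite p subsetI)
    fix w assume "w \<in> z ` ?S"
    then obtain \<kappa> where w: "w = z \<kappa>" and c: "cos (pi / n * (\<kappa> - m)) - cos (pi / n * \<kappa>) = c"
      by auto
    have "\<alpha> * w = cis (pi / n * (\<kappa> - m)) - cis (pi / n * \<kappa>)"
      by (simp add: \<alpha>_def w z_def left_diff_distrib cis_mult right_diff_distrib)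
    then have "Re (\<alpha> * w) = c" using c by simp
    then have "\<alpha> * w + cnj (\<alpha> * w) = of_real (2 * c)"
      by (simp only: complex_add_cnj)
    \<comment> \<open>On the unit circle \<open>cnj w\<close> is the inverse of \<open>w\<close>, so
      multiplying by \<open>w\<close> clears the conjugate and leaves a polynomial equation.\<close>
    then have "(\<alpha> * w + cnj \<alpha> * cnj w) * w = of_real (2 * c) * w"
      by (simp only: complex_cnj_mult)
    moreover have "cnj w * w = 1"
      by (simp add: w z_def cis_cnj cis_mult)
    ultimately have "\<alpha> * w * w + cnj \<alpha> = of_real (2 * c) * w"
      by (simp add: distrib_right mult.assoc)
    then show "w \<in> {x. poly p x = 0}"
      by (simp add: p_def algebra_simps)
  qed
  also have "\<dots> \<le> 2" using card_poly_roots_bound [OF p(1)] p(2) by simp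
  finally show ?thesis .
qed

section \<open>Plane waves and sine waves on the box\<close>

text \<open>Frequencies are functions rather than vectors, so that sums of products over the cube
  factorise through \<open>prod_sum_PiE\<close>.\<close>

definition freqs :: "int \<Rightarrow> int \<Rightarrow> ('d \<Rightarrow> int) set" where
  "freqs r s = (UNIV \<rightarrow>\<^sub>E {r..<s})"

text \<open>With angle \<open>pi / n\<close>, integer frequencies give the characters of the torus
  of side \<open>2 * n\<close>; the box of side \<open>N\<close> is later treated with
  \<open>n = Suc N\<close>.\<close>

definition plane_wave :: "nat \<Rightarrow> ('d::finite \<Rightarrow> int) \<Rightarrow> 'd wavefun" where
  "plane_wave n k x = (\<Prod>i\<in>UNIV. cis (pi / n * (k i * x $ i)))"

text \<open>
  The sine waves are indexed redundantly by all of \<open>(\<int> / 2 (N + 1))\<^sup>d\<close>: this is the odd reflection of the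
  Dirichlet box to a torus, expressed without leaving the box.
\<close>

definition sine_wave :: "nat \<Rightarrow> ('d::finite \<Rightarrow> int) \<Rightarrow> 'd wavefun" where
  "sine_wave n k x = (\<Prod>i\<in>UNIV. of_real (sin (pi / n * (k i * x $ i))))"

text \<open>The eigenvalue of the adjacency operator on the wave with frequency \<open>k\<close>;
  see \<open>dirichlet_adj_sine_wave\<close>.\<close>

definition energy :: "nat \<Rightarrow> ('d::finite \<Rightarrow> int) \<Rightarrow> real" where
  "energy n k = (\<Sum>i\<in>UNIV. 2 * cos (pi / n * k i))"

lemma finite_freqs: "finite (freqs r s :: ('d::finite \<Rightarrow> int) set)"
  unfolding freqs_def by (rule finite_PiE) auto

lemma sum_freqs_prod:
  fixes f :: "'d::finite \<Rightarrow> int \<Rightarrow> 'a::comm_semiring_1"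
  shows "(\<Sum>k\<in>freqs r s. \<Prod>i\<in>UNIV. f i (k i)) = (\<Prod>i\<in>UNIV. \<Sum>\<kappa>\<in>{r..<s}. f i \<kappa>)"
  unfolding freqs_def by (rule prod_sum_PiE [symmetric]) auto

lemma prod_if_vec_eq:
  fixes x y :: "'a ^ 'd::finite" and c :: "'b::comm_semiring_1"
  shows "(\<Prod>i\<in>UNIV. if x $ i = y $ i then c else 0) = (if x = y then c ^ CARD('d) else 0)"
proof (cases "x = y")
  case False
  then obtain i where "x $ i \<noteq> y $ i" by (auto simp: vec_eq_iff)
  then have "(\<Prod>i\<in>UNIV. if x $ i = y $ i then c else 0) = 0"
    by (intro prod_zero) auto
  with False show ?thesis by simp
qed simp

lemma lattice_box_nth:
  fixes x :: "int ^ 'd::finite"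
  assumes "x \<in> lattice_box N"
  shows "0 < x $ i" and "x $ i < int (Suc N)"
proof -
  have "1 \<le> x $ i \<and> x $ i \<le> int N"
    using assms by (simp add: lattice_box_def)
  then show "0 < x $ i" and "x $ i < int (Suc N)" by auto
qed

text \<open>In each coordinate only the sine part of the plane wave correlates with the sine, which
  contributes the factor \<open>\<i> * n\<close>. This is what makes plane waves a dual family to
  the sine waves.\<close>

lemma sum_sine_plane_wave:
  fixes x y :: "int ^ 'd::finite"
  assumes "x \<in> lattice_box N" "y \<in> lattice_box N"
  defines "n \<equiv> Suc N"
  shows "(\<Sum>k\<in>freqs 0 (2 * int n). sine_wave n k x * plane_wave n k y)
    = (if x = y then (\<i> * of_nat n) ^ CARD('d) else 0)"
proof -
  have "(\<Sum>k\<in>freqs 0 (2 * int n). sine_wave n k x * plane_wave n k y)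
      = (\<Prod>i\<in>UNIV. \<Sum>\<kappa>\<in>{0..<2 * int n}.
          of_real (sin (pi / n * (\<kappa> * x $ i))) * cis (pi / n * (\<kappa> * y $ i)))"
    unfolding sine_wave_def plane_wave_def prod.distrib [symmetric] by (rule sum_freqs_prod)
  also have "\<dots> = (\<Prod>i\<in>UNIV. if x $ i = y $ i then \<i> * of_nat n else 0)"
    using lattice_box_nth [OF assms(1)] lattice_box_nth [OF assms(2)]
    unfolding n_def by (intro prod.cong refl sum_sin_cis) blast+
  finally show ?thesis by (simp add: prod_if_vec_eq)
qed

text \<open>Each Dirichlet mode has squared norm \<open>n / 2\<close> per coordinate and occurs
  twice up to sign over a full period, hence the frame constant \<open>n\<close> per
  coordinate.\<close>

lemma sum_sine_wave:
  fixes x y :: "int ^ 'd::finite"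
  assumes "x \<in> lattice_box N" "y \<in> lattice_box N"
  defines "n \<equiv> Suc N"
  shows "(\<Sum>k\<in>freqs 0 (2 * int n). cnj (sine_wave n k x) * sine_wave n k y)
    = (if x = y then of_nat n ^ CARD('d) else 0)"
proof -
  have cs: "(\<Sum>\<kappa>\<in>{0..<2 * int n}. of_real (sin (pi / n * (\<kappa> * x $ i))) * of_real (sin (pi / n * (\<kappa> * y $ i))))
      = (if x $ i = y $ i then of_nat n else (0::complex))" for i
    using arg_cong [OF sum_sin_sin [of "x $ i" n "y $ i"], of complex_of_real]
      lattice_box_nth [OF assms(1), of i] lattice_box_nth [OF assms(2), of i]
    by (simp add: n_def del: of_nat_Suc split: if_splits)
  have "(\<Sum>k\<in>freqs 0 (2 * int n). cnj (sine_wave n k x) * sine_wave n k y)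
      = (\<Prod>i\<in>UNIV. \<Sum>\<kappa>\<in>{0..<2 * int n}.
          of_real (sin (pi / n * (\<kappa> * x $ i))) * of_real (sin (pi / n * (\<kappa> * y $ i))))"
    unfolding sine_wave_def cnj_prod complex_cnj_complex_of_real prod.distrib [symmetric]
    by (rule sum_freqs_prod)
  also have "\<dots> = (\<Prod>i\<in>UNIV. if x $ i = y $ i then of_nat n else 0)"
    unfolding cs ..
  finally show ?thesis by (simp add: prod_if_vec_eq)
qed

lemma cnj_plane_wave_mult:
  "cnj (plane_wave n k x) * plane_wave n l x = cnj (plane_wave n (\<lambda>i. k i - l i) x)"
  by (simp add: plane_wave_def cis_cnj cis_mult algebra_simps flip: prod.distrib)

text \<open>The range covers two periods, so that all differences of frequencies from one period lie
  in it without reduction modulo \<open>2 * n\<close>; the price is \<open>4 * n\<close> instead of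
  \<open>2 * n\<close> per coordinate.\<close>

lemma sum_plane_wave:
  fixes x y :: "int ^ 'd::finite"
  assumes "x \<in> lattice_box N" "y \<in> lattice_box N"
  defines "n \<equiv> Suc N"
  shows "(\<Sum>k\<in>freqs (- 2 * int n) (2 * int n). cnj (plane_wave n k x) * plane_wave n k y)
    = (if x = y then of_nat (4 * n) ^ CARD('d) else 0)"
proof -
  have cc: "(\<Sum>\<kappa>\<in>{- 2 * int n..<2 * int n}. cis (pi / n * (\<kappa> * (y $ i - x $ i))))
      = (if x $ i = y $ i then of_nat (4 * n) else 0)" for i
  proof -
    have "2 * int n dvd y $ i - x $ i \<longleftrightarrow> y $ i = x $ i"
      using lattice_box_nth [OF assms(1), of i] lattice_box_nth [OF assms(2), of i]
      by (intro dvd_diff_iff_eq) (simp add: n_def)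
    then show ?thesis
      using sum_cis_periods [of n "y $ i - x $ i" "- 2 * int n" 2] by (auto simp: n_def)
  qed
  have "(\<Sum>k\<in>freqs (- 2 * int n) (2 * int n). cnj (plane_wave n k x) * plane_wave n k y)
      = (\<Sum>k\<in>freqs (- 2 * int n) (2 * int n). \<Prod>i\<in>UNIV. cis (pi / n * (k i * (y $ i - x $ i))))"
    by (simp add: plane_wave_def cis_cnj cis_mult algebra_simps flip: prod.distrib)
  also have "\<dots> = (\<Prod>i\<in>UNIV. \<Sum>\<kappa>\<in>{- 2 * int n..<2 * int n}. cis (pi / n * (\<kappa> * (y $ i - x $ i))))"
    using sum_freqs_prod [of "\<lambda>i \<kappa>. cis (pi / n * (\<kappa> * (y $ i - x $ i)))"] by simp
  also have "\<dots> = (\<Prod>i\<in>UNIV. if x $ i = y $ i then of_nat (4 * n) else 0)"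
    unfolding cc ..
  finally show ?thesis by (simp add: prod_if_vec_eq)
qed

section \<open>Counting pairs of equal energy\<close>

text \<open>The coordinates other than \<open>i\<close> range freely over \<open>G\<close>. Once
  they are fixed to \<open>g\<close>, the energy equation has the constant \<open>h g\<close> on its
  right-hand side and \<open>card_cos_diff_le\<close> leaves at most two values for coordinate
  \<open>i\<close>.\<close>

lemma card_energy_eq_le:
  fixes m :: "'d::finite \<Rightarrow> int"
  assumes "n > 0" "\<not> 2 * int n dvd m i"
  shows "card {k \<in> freqs 0 (2 * int n). energy n (\<lambda>i. k i - m i) = energy n k}
    \<le> 2 * (2 * n) ^ (CARD('d) - 1)"
proof -
  define G where "G = (UNIV - {i}) \<rightarrow>\<^sub>E {0..<2 * int n}"
  define h where "h g = (\<Sum>j\<in>UNIV - {i}. cos (pi / n * g j) - cos (pi / n * (g j - m j)))"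
    for g :: "'d \<Rightarrow> int"
  define S where "S g = {\<kappa> \<in> {0..<2 * int n}. cos (pi / n * (\<kappa> - m i)) - cos (pi / n * \<kappa>) = h g}"
    for g
  have finG: "finite G" unfolding G_def by (rule finite_PiE) auto
  have finS: "finite (S g)" for g unfolding S_def by (rule finite_subset [of _ "{0..<2 * int n}"]) auto
  have "{k \<in> freqs 0 (2 * int n). energy n (\<lambda>i. k i - m i) = energy n k}
      \<subseteq> (\<lambda>(g, \<kappa>). g(i := \<kappa>)) ` (SIGMA g:G. S g)" (is "?A \<subseteq> _")
  proof
    fix k assume "k \<in> ?A"
    then have k: "k \<in> UNIV \<rightarrow>\<^sub>E {0..<2 * int n}"
      and e: "energy n (\<lambda>i. k i - m i) = energy n k"
      by (auto simp: freqs_def)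
    have g: "restrict k (UNIV - {i}) \<in> G"
      using k unfolding G_def PiE_iff by auto
    have "(\<Sum>j\<in>UNIV. cos (pi / n * (k j - m j)) - cos (pi / n * k j)) = 0"
      using e by (simp add: energy_def sum_subtractf flip: sum_distrib_left)
    then have "cos (pi / n * (k i - m i)) - cos (pi / n * k i)
        + (\<Sum>j\<in>UNIV - {i}. cos (pi / n * (k j - m j)) - cos (pi / n * k j)) = 0"
      by (subst (asm) sum.remove [of UNIV i]) auto
    moreover have "h (restrict k (UNIV - {i}))
        = - (\<Sum>j\<in>UNIV - {i}. cos (pi / n * (k j - m j)) - cos (pi / n * k j))"
      unfolding h_def sum_negf [symmetric] by (intro sum.cong) auto
    ultimately have "k i \<in> S (restrict k (UNIV - {i}))"
      using k by (auto simp: S_def)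
    moreover have "k = (restrict k (UNIV - {i}))(i := k i)" by auto
    ultimately show "k \<in> (\<lambda>(g, \<kappa>). g(i := \<kappa>)) ` (SIGMA g:G. S g)"
      using g by (intro image_eqI [of _ _ "(restrict k (UNIV - {i}), k i)"]) auto
  qed
  then have "card ?A \<le> card (SIGMA g:G. S g)"
    using finG finS by (intro surj_card_le) auto
  also have "\<dots> = (\<Sum>g\<in>G. card (S g))"
    using finG finS by simp
  also have "\<dots> \<le> (\<Sum>g\<in>G. 2)"
    unfolding S_def by (intro sum_mono card_cos_diff_le assms)
  also have "\<dots> = 2 * (2 * n) ^ (CARD('d) - 1)"
    by (simp add: G_def card_PiE nat_mult_distrib card_Diff_singleton)
  finally show ?thesis .
qed

section \<open>Sine waves as Dirichlet eigenfunctions\<close>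

text \<open>By integrality a single nonzero coordinate already uses up the whole norm.\<close>

lemma l1_norm_eq_1_iff:
  fixes z :: "int ^ 'd::finite"
  shows "l1_norm z = 1 \<longleftrightarrow> (\<exists>i. z = axis i 1 \<or> z = axis i (- 1))"
proof
  assume z: "l1_norm z = 1"
  then obtain i where i: "z $ i \<noteq> 0"
    by (force simp: l1_norm_def)
  have *: "\<bar>z $ i\<bar> + (\<Sum>j\<in>UNIV - {i}. \<bar>z $ j\<bar>) = 1"
    using z unfolding l1_norm_def by (subst (asm) sum.remove [of UNIV i]) auto
  moreover have "(\<Sum>j\<in>UNIV - {i}. \<bar>z $ j\<bar>) \<ge> 0" by (rule sum_nonneg) simp
  ultimately have zi: "\<bar>z $ i\<bar> = 1" and "(\<Sum>j\<in>UNIV - {i}. \<bar>z $ j\<bar>) = 0"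
    using i by linarith+
  then have "\<forall>j. j \<noteq> i \<longrightarrow> z $ j = 0"
    by (subst (asm) sum_nonneg_eq_0_iff) auto
  with zi show "\<exists>i. z = axis i 1 \<or> z = axis i (- 1)"
    by (intro exI [of _ i]) (auto simp: vec_eq_iff axis_def abs_if split: if_splits)
next
  assume "\<exists>i. z = axis i 1 \<or> z = axis i (- 1)"
  then show "l1_norm z = 1"
    by (auto simp: l1_norm_def axis_def if_distrib cong: if_cong)
qed

lemma sum_neighbours:
  fixes f :: "int ^ 'd::finite \<Rightarrow> 'a::comm_monoid_add"
  shows "(\<Sum>x | l1_norm (x - y) = 1. f x) = (\<Sum>i\<in>UNIV. f (y + axis i 1) + f (y + axis i (- 1)))"
proof -
  have "bij_betw (\<lambda>(i, s). y + axis i s) (UNIV \<times> {1, - 1 :: int}) {x. l1_norm (x - y) = 1}"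
  proof (rule bij_betwI')
    fix x assume "x \<in> {x. l1_norm (x - y) = 1}"
    then obtain i s where "s \<in> {1, - 1}" "x - y = axis i s"
      by (auto simp: l1_norm_eq_1_iff)
    then show "\<exists>p\<in>UNIV \<times> {1, - 1}. x = (case p of (i, s) \<Rightarrow> y + axis i s)"
      by (intro bexI [of _ "(i, s)"]) (auto simp: algebra_simps)
  qed (auto simp: axis_eq_axis l1_norm_eq_1_iff)
  from sum.reindex_bij_betw [OF this, of f]
  have "(\<Sum>x | l1_norm (x - y) = 1. f x) = (\<Sum>(i, s)\<in>UNIV \<times> {1, - 1 :: int}. f (y + axis i s))"
    by (simp add: case_prod_unfold)
  then show ?thesis
    by (simp add: sum.cartesian_product [symmetric])
qed

text \<open>Only the factor at \<open>i\<close> changes, and the addition formulas for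
  \<open>sin\<close> combine its two shifts.\<close>

lemma sine_wave_shift:
  "sine_wave n k (y + axis i 1) + sine_wave n k (y + axis i (- 1))
    = of_real (2 * cos (pi / n * k i)) * sine_wave n k y"
proof -
  define P :: complex where "P = (\<Prod>j\<in>UNIV - {i}. of_real (sin (pi / n * (k j * y $ j))))"
  have *: "sine_wave n k (y + axis i s) = of_real (sin (pi / n * (k i * (y $ i + s)))) * P" for s
    unfolding sine_wave_def P_def
    by (subst prod.remove [of UNIV i]) (auto simp: axis_def intro!: prod.cong)
  have sw: "sine_wave n k y = of_real (sin (pi / n * (k i * y $ i))) * P"
    unfolding sine_wave_def P_def by (subst prod.remove [of UNIV i]) auto
  have "pi / n * real_of_int (k i * (y $ i + 1)) = pi / n * real_of_int (k i * y $ i) + pi / n * k i"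
    and "pi / n * real_of_int (k i * (y $ i + - 1)) = pi / n * real_of_int (k i * y $ i) - pi / n * k i"
    by (simp_all add: algebra_simps add_divide_distrib diff_divide_distrib)
  then have "sin (pi / n * real_of_int (k i * (y $ i + 1))) + sin (pi / n * real_of_int (k i * (y $ i + - 1)))
      = 2 * cos (pi / n * k i) * sin (pi / n * real_of_int (k i * y $ i))"
    by (simp only: sin_add sin_diff) simp
  then show ?thesis
    unfolding * sw distrib_right [symmetric] of_real_add [symmetric] by simp
qed

text \<open>The Dirichlet condition: the walls \<open>x $ i = 0\<close> and \<open>x $ i = n\<close>
  are multiples of \<open>n\<close>, where one sine factor vanishes.\<close>

lemma sine_wave_eq_0:
  assumes "int n dvd x $ i"
  shows "sine_wave n k x = 0"
\<comment> \<open>For \<open>n = 0\<close> division by zero makes every angle 0, so all sine factors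
  vanish.\<close>
proof (cases "n = 0")
  case False
  from assms obtain q where "x $ i = int n * q" by (elim dvdE)
  with False have "pi / n * real_of_int (k i * x $ i) = pi * real_of_int (k i * q)"
    by simp
  then have "sin (pi / n * real_of_int (k i * x $ i)) = 0"
    by (simp only: sin_zero_iff_int2) (metis mult.commute)
  then show ?thesis
    unfolding sine_wave_def by (intro prod_zero) auto
qed (auto simp: sine_wave_def)

text \<open>Truncation loses nothing, because the sine wave vanishes at every neighbour outside the
  box; the eigenvalue is then that of the full lattice.\<close>

lemma dirichlet_adj_sine_wave:
  fixes y :: "int ^ 'd::finite"
  assumes y: "y \<in> lattice_box N"
  defines "n \<equiv> Suc N"
  shows "dirichlet_adj (lattice_box N) (sine_wave n k) y = of_real (energy n k) * sine_wave n k y"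
proof -
  have outside: "sine_wave n k x = 0" if nbr: "l1_norm (x - y) = 1" and x: "x \<notin> lattice_box N" for x
  proof -
    obtain i s where s: "s \<in> {1, - 1}" "x - y = axis i s"
      using nbr by (auto simp: l1_norm_eq_1_iff)
    then have xj: "x $ j = y $ j + (if j = i then s else 0)" for j
      by (auto simp: vec_eq_iff axis_def algebra_simps dest!: spec [of _ j])
    from x obtain j where j: "x $ j < 1 \<or> int N < x $ j"
      by (auto simp: lattice_box_def not_le)
    have "1 \<le> y $ j" "y $ j \<le> int N"
      using y by (simp_all add: lattice_box_def)
    \<comment> \<open>A unit step out of the box lands exactly on 0 or on \<open>N + 1\<close>,
      which is why \<open>n\<close> is \<open>Suc N\<close>.\<close>
    with j s(1) xj [of j] have "x $ j = 0 \<or> x $ j = int n"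
      by (auto simp: n_def split: if_splits)
    then show ?thesis
      by (intro sine_wave_eq_0 [of n x j]) auto
  qed
  have "finite {x. l1_norm (x - y) = 1}"
  proof (rule finite_subset)
    show "{x. l1_norm (x - y) = 1} \<subseteq> (\<lambda>(i, s). y + axis i s) ` (UNIV \<times> {1, - 1})"
      by (force simp: l1_norm_eq_1_iff algebra_simps)
  qed simp
  then have "dirichlet_adj (lattice_box N) (sine_wave n k) y
      = (\<Sum>x | l1_norm (x - y) = 1. sine_wave n k x)"
    unfolding dirichlet_adj_def using outside by (intro sum.mono_neutral_left) auto
  also have "\<dots> = of_real (energy n k) * sine_wave n k y"
    by (simp add: sum_neighbours sine_wave_shift energy_def sum_distrib_right)
  finally show ?thesis .
qed

text \<open>The pairing is bilinear, without conjugation, to match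
  \<open>sine_coeff\<close>.\<close>

lemma dirichlet_adj_symmetric:
  fixes \<phi> \<psi> :: "'d::finite wavefun"
  assumes "finite \<Gamma>"
  shows "(\<Sum>x\<in>\<Gamma>. \<phi> x * dirichlet_adj \<Gamma> \<psi> x) = (\<Sum>x\<in>\<Gamma>. dirichlet_adj \<Gamma> \<phi> x * \<psi> x)"
proof -
  have nm: "l1_norm (y - x) = l1_norm (x - y)" for x y :: "int ^ 'd"
    unfolding l1_norm_def by (simp add: abs_minus_commute)
  have adj: "dirichlet_adj \<Gamma> f x = (\<Sum>y\<in>\<Gamma>. if l1_norm (y - x) = 1 then f y else 0)"
    for f :: "'d wavefun" and x
    unfolding dirichlet_adj_def using assms by (simp add: sum.inter_filter)
  have "(\<Sum>x\<in>\<Gamma>. \<phi> x * dirichlet_adj \<Gamma> \<psi> x)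
      = (\<Sum>x\<in>\<Gamma>. \<Sum>y\<in>\<Gamma>. if l1_norm (y - x) = 1 then \<phi> x * \<psi> y else 0)"
    unfolding adj sum_distrib_left by (intro sum.cong) auto
  also have "\<dots> = (\<Sum>y\<in>\<Gamma>. \<Sum>x\<in>\<Gamma>. if l1_norm (x - y) = 1 then \<phi> x * \<psi> y else 0)"
    by (subst sum.swap) (simp only: nm)
  also have "\<dots> = (\<Sum>x\<in>\<Gamma>. dirichlet_adj \<Gamma> \<phi> x * \<psi> x)"
    unfolding adj sum_distrib_right by (intro sum.cong) auto
  finally show ?thesis .
qed

section \<open>Eigenfunctions and weights in frequency space\<close>

text \<open>This is the inner product with a sine wave; no conjugate appears because sine waves are
  real.\<close>

definition sine_coeff :: "nat \<Rightarrow> 'd::finite wavefun \<Rightarrow> ('d \<Rightarrow> int) \<Rightarrow> complex" where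
  "sine_coeff N \<psi> k = (\<Sum>x\<in>lattice_box N. sine_wave (Suc N) k x * \<psi> x)"

text \<open>Moving the adjacency operator onto the sine wave multiplies the coefficient by its
  energy, while the eigenvalue equation multiplies it by \<open>\<mu>\<close>. Thus an eigenfunction
  lives on one energy shell.\<close>

lemma energy_of_sine_coeff_nonzero:
  fixes \<psi> :: "'d::finite wavefun"
  assumes eig: "\<forall>x\<in>lattice_box N. dirichlet_adj (lattice_box N) \<psi> x = \<mu> * \<psi> x"
    and "sine_coeff N \<psi> k \<noteq> 0"
  shows "of_real (energy (Suc N) k) = \<mu>"
proof -
  have "\<mu> * sine_coeff N \<psi> k
      = (\<Sum>x\<in>lattice_box N. sine_wave (Suc N) k x * dirichlet_adj (lattice_box N) \<psi> x)"
    using eig by (simp add: sine_coeff_def sum_distrib_left mult_ac)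
  also have "\<dots> = (\<Sum>x\<in>lattice_box N. dirichlet_adj (lattice_box N) (sine_wave (Suc N) k) x * \<psi> x)"
    by (rule dirichlet_adj_symmetric [OF finite_lattice_box])
  also have "\<dots> = of_real (energy (Suc N) k) * sine_coeff N \<psi> k"
    by (simp add: dirichlet_adj_sine_wave sine_coeff_def sum_distrib_left mult_ac)
  finally show ?thesis using assms(2) by simp
qed

text \<open>
  The coefficients are odd in each coordinate of \<open>k\<close>, so plane waves may replace sine waves in the
  synthesis; matrix elements of a weight then depend on \<open>k - l\<close> only.
\<close>

lemma sine_coeff_inversion:
  fixes \<psi> :: "'d::finite wavefun"
  assumes x: "x \<in> lattice_box N"
  defines "n \<equiv> Suc N"
  shows "(\<Sum>k\<in>freqs 0 (2 * int n). sine_coeff N \<psi> k * plane_wave n k x)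
    = (\<i> * of_nat n) ^ CARD('d) * \<psi> x"
proof -
  have "(\<Sum>k\<in>freqs 0 (2 * int n). sine_coeff N \<psi> k * plane_wave n k x)
     = (\<Sum>y\<in>lattice_box N. \<psi> y *
          (\<Sum>k\<in>freqs 0 (2 * int n). sine_wave n k y * plane_wave n k x))"
    unfolding sine_coeff_def sum_distrib_right sum_distrib_left n_def
    by (subst sum.swap) (simp add: mult_ac)
  also have "\<dots> = (\<Sum>y\<in>lattice_box N. if y = x then \<psi> y * (\<i> * of_nat n) ^ CARD('d) else 0)"
    using x unfolding n_def by (intro sum.cong refl) (subst sum_sine_plane_wave, auto)
  also have "\<dots> = (\<i> * of_nat n) ^ CARD('d) * \<psi> x"
    using x by (simp add: finite_lattice_box)
  finally show ?thesis .
qed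

definition weight_transform :: "nat \<Rightarrow> 'd::finite wavefun \<Rightarrow> ('d \<Rightarrow> int) \<Rightarrow> complex" where
  "weight_transform N b m = (\<Sum>x\<in>lattice_box N. cnj (plane_wave (Suc N) m x) * b x)"

text \<open>Both copies of \<open>\<psi> x\<close> are replaced by their plane-wave synthesis. The
  product of the two waves depends on \<open>k - l\<close> only, so summing over \<open>x\<close>
  produces the transform of \<open>b\<close>.\<close>

lemma weighted_norm_eq:
  fixes \<psi> b :: "'d::finite wavefun" and N :: nat
  defines "n \<equiv> Suc N"
  shows "of_nat n ^ (2 * CARD('d)) * (\<Sum>x\<in>lattice_box N. b x * of_real ((cmod (\<psi> x))\<^sup>2))
    = (\<Sum>(k, l)\<in>freqs 0 (2 * int n) \<times> freqs 0 (2 * int n).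
        cnj (sine_coeff N \<psi> k) * sine_coeff N \<psi> l * weight_transform N b (\<lambda>i. k i - l i))"
proof -
  let ?K = "freqs 0 (2 * int n) :: ('d \<Rightarrow> int) set"
  let ?S = "\<lambda>x. \<Sum>k\<in>?K. sine_coeff N \<psi> k * plane_wave n k x"
  have "of_nat n ^ (2 * CARD('d)) * (b x * of_real ((cmod (\<psi> x))\<^sup>2)) = b x * (cnj (?S x) * ?S x)"
    if "x \<in> lattice_box N" for x
  proof -
    \<comment> \<open>The phases from the inversion formula cancel, leaving \<open>n\<close> squared
      per coordinate.\<close>
    have "cnj (\<i> * of_nat n) * (\<i> * of_nat n) = (of_nat n)\<^sup>2"
      by (simp add: complex_eq_iff power2_eq_square)
    then have "cnj ((\<i> * of_nat n) ^ CARD('d)) * (\<i> * of_nat n) ^ CARD('d) = (of_nat n ^ (2 * CARD('d)) :: complex)"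
      unfolding complex_cnj_power power_mult_distrib [symmetric] power_mult by simp
    then show ?thesis
      using sine_coeff_inversion [OF that, of \<psi>] unfolding complex_norm_square n_def
      by (simp only: complex_cnj_mult mult_ac)
  qed
  then have "of_nat n ^ (2 * CARD('d)) * (\<Sum>x\<in>lattice_box N. b x * of_real ((cmod (\<psi> x))\<^sup>2))
      = (\<Sum>x\<in>lattice_box N. b x * (cnj (?S x) * ?S x))"
    by (simp add: sum_distrib_left)
  also have "\<dots> = (\<Sum>x\<in>lattice_box N. \<Sum>(k, l)\<in>?K \<times> ?K.
      cnj (sine_coeff N \<psi> k) * sine_coeff N \<psi> l * (cnj (plane_wave n (\<lambda>i. k i - l i) x) * b x))"
  proof (rule sum.cong [OF refl])
    fix x
    have "cnj (?S x) * ?S x = (\<Sum>(k, l)\<in>?K \<times> ?K.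
        cnj (sine_coeff N \<psi> k) * sine_coeff N \<psi> l * cnj (plane_wave n (\<lambda>i. k i - l i) x))"
      unfolding cnj_sum sum_product sum.cartesian_product
      by (simp add: mult_ac flip: cnj_plane_wave_mult)
    then show "b x * (cnj (?S x) * ?S x) = (\<Sum>(k, l)\<in>?K \<times> ?K.
        cnj (sine_coeff N \<psi> k) * sine_coeff N \<psi> l * (cnj (plane_wave n (\<lambda>i. k i - l i) x) * b x))"
      by (simp add: sum_distrib_left case_prod_unfold mult_ac)
  qed
  also have "\<dots> = (\<Sum>(k, l)\<in>?K \<times> ?K.
        cnj (sine_coeff N \<psi> k) * sine_coeff N \<psi> l * weight_transform N b (\<lambda>i. k i - l i))"
    unfolding weight_transform_def n_def
    by (subst sum.swap) (simp add: case_prod_unfold sum_distrib_left)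
  finally show ?thesis .
qed

lemma weight_transform_parseval:
  fixes b :: "'d::finite wavefun" and N :: nat
  defines "n \<equiv> Suc N"
  shows "(\<Sum>m\<in>freqs (- 2 * int n) (2 * int n). (cmod (weight_transform N b m))\<^sup>2)
    = real (4 * n) ^ CARD('d) * (\<Sum>x\<in>lattice_box N. (cmod (b x))\<^sup>2)"
proof -
  have "(\<Sum>m\<in>freqs (- 2 * int n) (2 * int n). cnj (weight_transform N b m) * weight_transform N b m)
      = of_nat (4 * n) ^ CARD('d) * (\<Sum>x\<in>lattice_box N. cnj (b x) * b x)"
    unfolding weight_transform_def n_def
  proof (rule parseval [OF finite_lattice_box])
    fix x y :: "int ^ 'd" assume "x \<in> lattice_box N" "y \<in> lattice_box N"
    then show "(\<Sum>k\<in>freqs (- 2 * int (Suc N)) (2 * int (Suc N)).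
          cnj (cnj (plane_wave (Suc N) k x)) * cnj (plane_wave (Suc N) k y))
        = (if x = y then of_nat (4 * Suc N) ^ CARD('d) else 0)"
      \<comment> \<open>Conjugating the waves exchanges the roles of \<open>x\<close> and
        \<open>y\<close>.\<close>
      using sum_plane_wave [of y N x] by (simp add: mult.commute eq_commute [of x])
  qed
  then have "complex_of_real (\<Sum>m\<in>freqs (- 2 * int n) (2 * int n). (cmod (weight_transform N b m))\<^sup>2)
      = of_real (real (4 * n) ^ CARD('d) * (\<Sum>x\<in>lattice_box N. (cmod (b x))\<^sup>2))"
    unfolding of_real_mult of_real_sum complex_norm_square
    by (simp add: mult.commute)
  then show ?thesis by (simp only: of_real_eq_iff)
qed

section \<open>The variance bound at fixed size\<close>

lemma resonant_weight_sum_le: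
  fixes b :: "'d::finite wavefun" and N :: nat
  assumes mean: "(\<Sum>x\<in>lattice_box N. b x) = 0"
  defines "n \<equiv> Suc N"
  defines "K \<equiv> freqs 0 (2 * int n)"
  shows "(\<Sum>(k, l)\<in>{(k, l)\<in>K \<times> K. energy n k = energy n l}. (cmod (weight_transform N b (\<lambda>i. k i - l i)))\<^sup>2)
    \<le> real (2 * (2 * n) ^ (CARD('d) - 1)) * real (4 * n) ^ CARD('d)
        * (\<Sum>x\<in>lattice_box N. (cmod (b x))\<^sup>2)"
proof -
  define W where "W m = (cmod (weight_transform N b m))\<^sup>2" for m
  define P where "P = {(k, l)\<in>K \<times> K. energy n k = energy n l}"
  define S where "S m = {k \<in> K. energy n (\<lambda>i. k i - m i) = energy n k}" for m
  \<comment> \<open>The strict bound on \<open>m i\<close> ensures that a nonzero entry is not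
    divisible by \<open>2 * n\<close>, as the counting lemma requires.\<close>
  define M where "M = {m :: 'd \<Rightarrow> int. m \<in> freqs (- 2 * int n) (2 * int n) \<and> (\<forall>i. \<bar>m i\<bar> < 2 * int n)}"
  define C where "C = real (2 * (2 * n) ^ (CARD('d) - 1))"
  define f where "f = (\<lambda>(k, l). (\<lambda>i. k i - l i :: int, k :: 'd \<Rightarrow> int))"
  have n: "n > 0" by (simp add: n_def)
  have finM: "finite M" unfolding M_def by (rule finite_subset [OF _ finite_freqs]) auto
  have finS: "finite (S m)" for m by (simp add: S_def K_def finite_freqs)
  have inj: "inj_on f P"
    by (auto simp: inj_on_def f_def fun_eq_iff)
  have sub: "f ` P \<subseteq> (SIGMA m:M. S m)"
  proof (rule subrelI)
    fix m k assume "(m, k) \<in> f ` P"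
    then obtain l where m: "m = (\<lambda>i. k i - l i)" and kl: "k \<in> K" "l \<in> K" "energy n k = energy n l"
      by (auto simp: f_def P_def)
    have "\<bar>m i\<bar> < 2 * int n" for i
      using kl(1,2) by (auto simp: m K_def freqs_def PiE_iff abs_less_iff dest!: spec [of _ i])
    moreover from this have "m \<in> freqs (- 2 * int n) (2 * int n)"
      by (auto simp: freqs_def abs_less_iff less_imp_le minus_less_iff)
    ultimately show "(m, k) \<in> (SIGMA m:M. S m)"
      using kl by (simp add: M_def S_def m)
  qed
  have "(\<Sum>(k, l)\<in>P. W (\<lambda>i. k i - l i)) = (\<Sum>p\<in>f ` P. W (fst p))"
    by (subst sum.reindex [OF inj]) (simp add: f_def case_prod_unfold o_def)
  \<comment> \<open>Membership in \<open>S m\<close> does not ask that \<open>k - m\<close> lie in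
    \<open>K\<close>; the extra terms are nonnegative.\<close>
  also have "\<dots> \<le> (\<Sum>p\<in>(SIGMA m:M. S m). W (fst p))"
    using finM finS sub by (intro sum_mono2) (auto simp: W_def)
  also have "\<dots> = (\<Sum>m\<in>M. \<Sum>k\<in>S m. W m)"
    using finM finS by (subst sum.Sigma) (auto simp: case_prod_unfold)
  also have "\<dots> \<le> (\<Sum>m\<in>M. C * W m)"
  proof (rule sum_mono)
    fix m assume m: "m \<in> M"
    show "(\<Sum>k\<in>S m. W m) \<le> C * W m"
    proof (cases "m = (\<lambda>i. 0)")
      case True
      then have "W m = 0"
        using mean by (simp add: W_def weight_transform_def plane_wave_def)
      then show ?thesis by simp
    next
      case False
      then obtain i where "m i \<noteq> 0" by (auto simp: fun_eq_iff)
      moreover have "\<bar>m i\<bar> < 2 * int n" using m by (simp add: M_def)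
      ultimately have "\<not> 2 * int n dvd m i"
        using dvd_diff_iff_eq [of "m i" 0 "2 * int n"] by simp
      from card_energy_eq_le [of n m i, OF n this] have "real (card (S m)) \<le> C"
        unfolding C_def S_def K_def by (rule of_nat_mono)
      then show ?thesis
        by (simp add: W_def mult_right_mono)
    qed
  qed
  \<comment> \<open>Enlarging \<open>M\<close> to two full periods makes Parseval
    applicable.\<close>
  also have "\<dots> \<le> (\<Sum>m\<in>freqs (- 2 * int n) (2 * int n). C * W m)"
    by (rule sum_mono2) (auto simp: M_def C_def W_def finite_freqs)
  also have "\<dots> = C * real (4 * n) ^ CARD('d) * (\<Sum>x\<in>lattice_box N. (cmod (b x))\<^sup>2)"
    unfolding sum_distrib_left [symmetric] W_def n_def weight_transform_parseval by simp
  finally show ?thesis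
    unfolding P_def W_def C_def .
qed

text \<open>For bounded \<open>b\<close> the right-hand side is of order \<open>N ^ (d - 1)\<close>,
  one power below the number of basis functions.\<close>

lemma eigenbasis_variance_le:
  fixes \<psi> :: "'j \<Rightarrow> 'd::finite wavefun" and b :: "'d wavefun"
  assumes "finite J"
    and orth: "\<And>i j. i \<in> J \<Longrightarrow> j \<in> J \<Longrightarrow>
      l2_inner (lattice_box N) (\<psi> i) (\<psi> j) = (if i = j then 1 else 0)"
    and eigen: "\<And>j. j \<in> J \<Longrightarrow> eigenfunction_on (lattice_box N) (dirichlet_adj (lattice_box N)) (\<psi> j)"
    and mean: "(\<Sum>x\<in>lattice_box N. b x) = 0"
  shows "(\<Sum>j\<in>J. (cmod (\<Sum>x\<in>lattice_box N. b x * of_real ((cmod (\<psi> j x))\<^sup>2)))\<^sup>2)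
    \<le> 8 ^ CARD('d) / real (Suc N) * (\<Sum>x\<in>lattice_box N. (cmod (b x))\<^sup>2)"
proof -
  define n where "n = Suc N"
  define K where "K = (freqs 0 (2 * int n) :: ('d \<Rightarrow> int) set)"
  define c where "c j = sine_coeff N (\<psi> j)" for j
  define w where "w j = (\<Sum>x\<in>lattice_box N. b x * complex_of_real ((cmod (\<psi> j x))\<^sup>2))" for j
  \<comment> \<open>The rank-one matrices \<open>c\<^sub>j c\<^sub>j\<^sup>*\<close> are orthogonal, and each is supported on a single energy shell,
    so pairing with \<open>B\<close> loses nothing against the full matrix of the weight.\<close>
  define v where "v j = (\<lambda>(k, l). c j k * cnj (c j l))" for j
  define B where "B = (\<lambda>(k, l). if energy n k = energy n l then weight_transform N b (\<lambda>i. k i - l i) else 0)"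
  define D where "D = real n ^ (2 * CARD('d))"
  define V where "V = (\<Sum>x\<in>lattice_box N. (cmod (b x))\<^sup>2)"
  have n: "n > 0" by (simp add: n_def)
  then have D: "D > 0" by (simp add: D_def)
  have finK: "finite K" by (simp add: K_def finite_freqs)
  have cc: "(\<Sum>k\<in>K. cnj (c i k) * c j k) = (if i = j then of_nat n ^ CARD('d) else 0)"
    if "i \<in> J" "j \<in> J" for i j
  proof -
    have "(\<Sum>k\<in>K. cnj (c i k) * c j k)
        = of_nat n ^ CARD('d) * (\<Sum>x\<in>lattice_box N. cnj (\<psi> i x) * \<psi> j x)"
      unfolding c_def sine_coeff_def K_def n_def
      by (intro parseval finite_lattice_box sum_sine_wave)
    then show ?thesis
      using orth [OF that] by (simp add: l2_inner_def)
  qed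
  \<comment> \<open>The Hilbert-Schmidt product of two rank-one matrices is the squared modulus of
    the product of their vectors; by \<open>cc\<close> the squared norm is \<open>n ^ d\<close>
    squared, that is \<open>D\<close>.\<close>
  have "(\<Sum>p\<in>K \<times> K. cnj (v i p) * v j p) = (if i = j then of_real D else 0)"
    if "i \<in> J" "j \<in> J" for i j
  proof -
    have "(\<Sum>p\<in>K \<times> K. cnj (v i p) * v j p)
        = (\<Sum>k\<in>K. cnj (c i k) * c j k) * cnj (\<Sum>k\<in>K. cnj (c i k) * c j k)"
      unfolding cnj_sum sum_product sum.cartesian_product
      by (simp add: v_def case_prod_unfold mult_ac)
    also have "\<dots> = (if i = j then of_real D else 0)"
      by (simp add: cc [OF that] D_def mult_2 power_add)
    finally show ?thesis .
  qed
  then have bessel: "(\<Sum>j\<in>J. (cmod (\<Sum>p\<in>K \<times> K. cnj (v j p) * B p))\<^sup>2)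
      \<le> D * (\<Sum>p\<in>K \<times> K. (cmod (B p))\<^sup>2)"
    by (intro bessel_inequality \<open>finite J\<close> D)
  \<comment> \<open>Where \<open>B\<close> was set to zero the energies differ, so one of the two
    coefficients in \<open>v j\<close> vanishes as well; the full quadratic form is
    recovered.\<close>
  have vB: "(\<Sum>p\<in>K \<times> K. cnj (v j p) * B p) = of_real D * w j" if j: "j \<in> J" for j
  proof -
    obtain \<mu> where \<mu>: "\<forall>x\<in>lattice_box N. dirichlet_adj (lattice_box N) (\<psi> j) x = \<mu> * \<psi> j x"
      using eigen [OF j] by (auto simp: eigenfunction_on_def)
    have "energy n k = energy n l" if "c j k \<noteq> 0" "c j l \<noteq> 0" for k l
    proof -
      have "complex_of_real (energy n k) = of_real (energy n l)"
        using energy_of_sine_coeff_nonzero [OF \<mu>] that unfolding c_def n_def by metis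
      then show ?thesis by simp
    qed
    then have "cnj (v j p) * B p
        = (case p of (k, l) \<Rightarrow> cnj (c j k) * c j l * weight_transform N b (\<lambda>i. k i - l i))" for p
      by (cases p) (auto simp: v_def B_def)
    then have "(\<Sum>p\<in>K \<times> K. cnj (v j p) * B p)
       = (\<Sum>(k, l)\<in>K \<times> K. cnj (c j k) * c j l * weight_transform N b (\<lambda>i. k i - l i))"
      by simp
    also have "\<dots> = of_real D * w j"
      using weighted_norm_eq [of N b "\<psi> j"] by (simp add: w_def D_def n_def K_def c_def)
    finally show ?thesis .
  qed
  have "(\<Sum>p\<in>K \<times> K. (cmod (B p))\<^sup>2)
      = (\<Sum>p\<in>K \<times> K. if energy n (fst p) = energy n (snd p)
          then (cmod (weight_transform N b (\<lambda>i. fst p i - snd p i)))\<^sup>2 else 0)"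
    by (intro sum.cong) (auto simp: B_def)
  also have "\<dots> = (\<Sum>p\<in>{p \<in> K \<times> K. energy n (fst p) = energy n (snd p)}.
          (cmod (weight_transform N b (\<lambda>i. fst p i - snd p i)))\<^sup>2)"
    using finK by (intro sum.inter_filter [symmetric]) simp
  also have "{p \<in> K \<times> K. energy n (fst p) = energy n (snd p)}
      = {(k, l)\<in>K \<times> K. energy n k = energy n l}"
    by auto
  also have "(\<Sum>p\<in>{(k, l)\<in>K \<times> K. energy n k = energy n l}.
          (cmod (weight_transform N b (\<lambda>i. fst p i - snd p i)))\<^sup>2)
      = (\<Sum>(k, l)\<in>{(k, l)\<in>K \<times> K. energy n k = energy n l}.
          (cmod (weight_transform N b (\<lambda>i. k i - l i)))\<^sup>2)"
    by (simp only: case_prod_unfold)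
  also have "\<dots> \<le> real (2 * (2 * n) ^ (CARD('d) - 1)) * real (4 * n) ^ CARD('d) * V"
    unfolding V_def n_def K_def by (rule resonant_weight_sum_le [OF mean])
  \<comment> \<open>The count contributes \<open>(2 * n) ^ d / n\<close> and Parseval
    \<open>(4 * n) ^ d\<close>; their product is \<open>8 ^ d * n ^ (2 * d) / n\<close>.\<close>
  also have "\<dots> = D * (8 ^ CARD('d) / real n * V)"
  proof -
    have "real (2 * (2 * n) ^ (CARD('d) - 1)) * n = real (2 * n) ^ CARD('d)"
      by (subst (2) power_eq_if) simp
    then have "real (2 * (2 * n) ^ (CARD('d) - 1)) * real (4 * n) ^ CARD('d) * n
        = real (2 * n) ^ CARD('d) * real (4 * n) ^ CARD('d)"
      by (metis mult.assoc mult.commute)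
    also have "\<dots> = ((real n)\<^sup>2 * 8) ^ CARD('d)"
      unfolding power_mult_distrib [symmetric] by (simp add: power2_eq_square)
    also have "\<dots> = D * 8 ^ CARD('d)"
      unfolding D_def power_mult by (rule power_mult_distrib)
    finally have "real (2 * (2 * n) ^ (CARD('d) - 1)) * real (4 * n) ^ CARD('d)
        = D * (8 ^ CARD('d) / real n)"
      using n by (simp add: eq_divide_eq)
    then show ?thesis by simp
  qed
  finally have "D * (\<Sum>p\<in>K \<times> K. (cmod (B p))\<^sup>2) \<le> D * (D * (8 ^ CARD('d) / real n * V))"
    using D by (intro mult_left_mono) simp_all
  \<comment> \<open>On the left \<open>D\<close> squared comes from \<open>vB\<close>; on the right
    one \<open>D\<close> comes from Bessel and one from the resonance bound, so the scaling
    cancels.\<close>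
  with bessel have "(\<Sum>j\<in>J. (cmod (of_real D * w j))\<^sup>2) \<le> D * (D * (8 ^ CARD('d) / real n * V))"
    by (simp add: vB)
  also have "(\<Sum>j\<in>J. (cmod (of_real D * w j))\<^sup>2) = D * (D * (\<Sum>j\<in>J. (cmod (w j))\<^sup>2))"
    using D by (simp add: norm_mult sum_distrib_left power2_eq_square mult_ac)
  finally show ?thesis
    unfolding mult_le_cancel_left_pos [OF D] w_def n_def V_def .
qed

section \<open>The limit of large boxes\<close>

theorem theorem1p1:
  fixes \<psi> :: "nat \<Rightarrow> nat \<Rightarrow> ('d::finite) wavefun"
    and a :: "nat \<Rightarrow> 'd observable"
  assumes basis: "\<And>N. N \<ge> 1 \<Longrightarrow> orthonormal_basis_on (lattice_box N) {1..N ^ CARD('d)} (\<psi> N)"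
    and eigen: "\<And>N j. N \<ge> 1 \<Longrightarrow> j \<in> {1..N ^ CARD('d)} \<Longrightarrow>
                  eigenfunction_on (lattice_box N) (dirichlet_adj (lattice_box N)) (\<psi> N j)"
    and diag: "\<And>N. N \<ge> 1 \<Longrightarrow> diagonal_obs (lattice_box N) (a N)"
    and bound: "\<And>N. N \<ge> 1 \<Longrightarrow> diag_sup_norm (lattice_box N) (a N) \<le> 1"
  shows "(\<lambda>N. (1 / real (N ^ CARD('d))) *
            (\<Sum>j = 1..N ^ CARD('d).
               (cmod (l2_inner (lattice_box N) (\<psi> N j) (obs_apply (lattice_box N) (a N) (\<psi> N j))
                      - obs_average (lattice_box N) (a N)))\<^sup>2))
         \<longlonglongrightarrow> 0"
    (is "?var \<longlonglongrightarrow> 0")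
proof (rule tendsto_sandwich)
  show "eventually (\<lambda>N. 0 \<le> ?var N) sequentially"
    by (intro always_eventually allI mult_nonneg_nonneg sum_nonneg) auto
  \<comment> \<open>The factor 4 bounds the squared modulus of the centred observable, whose value
    and mean both have modulus at most 1.\<close>
  show "eventually (\<lambda>N. ?var N \<le> 4 * 8 ^ CARD('d) / real (Suc N)) sequentially"
  proof (rule eventually_sequentiallyI [of 1])
    fix N :: nat assume N: "1 \<le> N"
    let ?\<Gamma> = "lattice_box N :: (int ^ 'd) set"
    let ?J = "{1..N ^ CARD('d)}"
    define avg where "avg = obs_average ?\<Gamma> (a N)"
    define b where "b x = a N x x - avg" for x
    have card: "card ?\<Gamma> = N ^ CARD('d)" by (rule card_lattice_box)
    then have card_pos: "card ?\<Gamma> > 0" using N by simp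
    have orth: "l2_inner ?\<Gamma> (\<psi> N i) (\<psi> N j) = (if i = j then 1 else 0)"
      if "i \<in> ?J" "j \<in> ?J" for i j
      using basis [OF N] that by (simp add: orthonormal_basis_on_def)
    have mean: "(\<Sum>x\<in>?\<Gamma>. b x) = 0"
      using card_pos by (simp add: b_def avg_def obs_average_def sum_subtractf)
    have a1: "cmod (a N x x) \<le> 1" if "x \<in> ?\<Gamma>" for x
    proof -
      have "cmod (a N x x) \<le> diag_sup_norm ?\<Gamma> (a N)"
        unfolding diag_sup_norm_def using that
        by (intro cSUP_upper bdd_above_finite finite_imageI finite_lattice_box)
      with bound [OF N] show ?thesis by simp
    qed
    have "cmod (\<Sum>x\<in>?\<Gamma>. a N x x) \<le> card ?\<Gamma>"
      using sum_norm_bound [of ?\<Gamma> "\<lambda>x. a N x x" 1] a1 by simp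
    then have "cmod avg \<le> 1"
      using card_pos by (simp add: avg_def obs_average_def norm_divide divide_le_eq)
    have b2: "(cmod (b x))\<^sup>2 \<le> 4" if "x \<in> ?\<Gamma>" for x
    proof -
      have "cmod (b x) \<le> 2"
        using norm_triangle_ineq4 [of "a N x x" avg] a1 [OF that] \<open>cmod avg \<le> 1\<close>
        by (simp add: b_def)
      then show ?thesis using power_mono [of "cmod (b x)" 2 2] by simp
    qed
    \<comment> \<open>Normalisation of \<open>\<psi> N j\<close> lets the constant
      \<open>avg\<close> be absorbed into the weight.\<close>
    have "l2_inner ?\<Gamma> (\<psi> N j) (obs_apply ?\<Gamma> (a N) (\<psi> N j)) - avg
        = (\<Sum>x\<in>?\<Gamma>. b x * of_real ((cmod (\<psi> N j x))\<^sup>2))" if j: "j \<in> ?J" for j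
    proof -
      have "(\<Sum>x\<in>?\<Gamma>. complex_of_real ((cmod (\<psi> N j x))\<^sup>2)) = 1"
        using orth [OF j j] unfolding l2_inner_def complex_norm_square by (simp add: mult.commute)
      then show ?thesis
        by (simp add: l2_inner_diagonal_obs [OF finite_lattice_box diag [OF N]] b_def
            left_diff_distrib sum_subtractf flip: sum_distrib_left)
    qed
    then have "(\<Sum>j\<in>?J. (cmod (l2_inner ?\<Gamma> (\<psi> N j) (obs_apply ?\<Gamma> (a N) (\<psi> N j)) - avg))\<^sup>2)
        = (\<Sum>j\<in>?J. (cmod (\<Sum>x\<in>?\<Gamma>. b x * of_real ((cmod (\<psi> N j x))\<^sup>2)))\<^sup>2)"
      by simp
    also have "\<dots> \<le> 8 ^ CARD('d) / real (Suc N) * (\<Sum>x\<in>?\<Gamma>. (cmod (b x))\<^sup>2)"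
      by (rule eigenbasis_variance_le) (use orth eigen [OF N] mean in auto)
    also have "\<dots> \<le> 8 ^ CARD('d) / real (Suc N) * (4 * real (N ^ CARD('d)))"
      using sum_mono [of ?\<Gamma> "\<lambda>x. (cmod (b x))\<^sup>2" "\<lambda>_. 4", OF b2] by (intro mult_left_mono) (simp_all add: card)
    finally show "?var N \<le> 4 * 8 ^ CARD('d) / real (Suc N)"
      using N unfolding avg_def by (simp add: field_simps)
  qed
  show "(\<lambda>N. 4 * 8 ^ CARD('d) / real (Suc N)) \<longlonglongrightarrow> 0"
    using LIMSEQ_Suc [OF lim_const_over_n [of "4 * 8 ^ CARD('d) :: real"]] by simp
qed simp

end
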